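(* Let $K\subseteq\mathbb{R}^n$ be an origin-symmetric convex body. Then $$\#(K)^{\frac{n-1}{n}} > \frac{1}{4^{n-1}}\Big(\prod_{i=1}^n \#(K\cap \mathbf{e}_i^\perp)\Big)^{\frac1n}.$$
   Context: A convex body in $\mathbb{R}^n$ is a compact convex set $K\subseteq\mathbb{R}^n$; it is origin-symmetric if $K=-K$. For $M\subseteq\mathbb{R}^n$, $\#(M)=|M\cap\mathbb{Z}^n|$ is the number of integer points in $M$. $\mathbf{e}_i$ is the $i$-th standard unit vector and $\mathbf{e}_i^\perp=\{\mathbf{x}\in\mathbb{R}^n: x_i=0\}$ is the coordinate hyperplane orthogonal to it.
   Formalization: The formal statement assumes n ≥ 2 and K nonempty: for n = 1 and nonempty K both sides equal 1, and for empty K with n ≥ 2 both sides equal 0, so the strict inequality fails there. *)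

theory Defs
  imports "HOL-Analysis.Analysis"
begin

text \<open>As in the source, a convex body need not have interior points.\<close>

definition convex_body :: "(real ^ 'n) set \<Rightarrow> bool" where
  "convex_body K \<longleftrightarrow> compact K \<and> convex K"

definition origin_symmetric :: "(real ^ 'n) set \<Rightarrow> bool" where
  "origin_symmetric K \<longleftrightarrow> K = uminus ` K"

definition integer_points :: "(real ^ 'n) set" where
  "integer_points = {x. \<forall>i. x $ i \<in> \<int>}"

text \<open>
  The cardinality is the junk value 0 if \<open>M\<close> contains infinitely many integer points;
  bounded sets, in particular convex bodies, contain only finitely many.
\<close>

definition lattice_count :: "(real ^ 'n) set \<Rightarrow> nat" where
  "lattice_count M = card (M \<inter> integer_points)"

definition coord_hyperplane :: "'n \<Rightarrow> (real ^ 'n) set" where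
  "coord_hyperplane i = {x. x $ i = 0}"

end

theory Submission
  imports Defs
begin

text \<open>
  For integer points \<open>a\<^sub>i \<in> K \<inter> e\<^sub>i\<^sup>\<bottom>\<close>, the \<open>n - 1\<close> consecutive sums \<open>a\<^sub>k + a\<^sub>k\<^sub>+\<^sub>1\<close> lie in \<open>2K\<close>, and
  they determine all \<open>a\<^sub>i\<close>: if two families have the same sums, their differences \<open>d\<^sub>k\<close> satisfy
  \<open>d\<^sub>k = \<plusminus>d\<^sub>0\<close>, and the \<open>k\<close>-th coordinate of \<open>d\<^sub>k\<close> is 0, so \<open>d\<^sub>0 = 0\<close>. Hence
  \<open>\<Prod>\<^sub>i #(K \<inter> e\<^sub>i\<^sup>\<bottom>) \<le> #(2K)\<^sup>n\<^sup>-\<^sup>1\<close>. For points \<open>x\<close>, \<open>y\<close> of \<open>2K\<close> congruent modulo 4,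
  \<open>(x - y) / 4\<close> is an integer point of \<open>K\<close>; hence \<open>#(2K) \<le> 4\<^sup>n #(K)\<close>. The inequality is strict
  unless \<open>#(K) = 1\<close>, because the class of 0 contributes only \<open>#(K/2)\<close> points.
\<close>

lemma finite_bounded_integer_points:
  fixes M :: "(real ^ 'n) set"
  assumes "bounded M"
  shows "finite (M \<inter> integer_points)"
proof -
  obtain B where B: "\<And>x. x \<in> M \<Longrightarrow> norm x \<le> B"
    using assms unfolding bounded_iff by blast
  let ?F = "{r::real. r \<in> \<int> \<and> \<bar>r\<bar> \<le> B}"
  have "finite (vec_lambda ` PiE (UNIV :: 'n set) (\<lambda>_. ?F))"
    by (intro finite_imageI finite_PiE finite_abs_int_segment) simp
  moreover have "M \<inter> integer_points \<subseteq> vec_lambda ` PiE (UNIV :: 'n set) (\<lambda>_. ?F)"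
  proof
    fix x assume x: "x \<in> M \<inter> integer_points"
    then have "x $ i \<in> ?F" for i
      using B component_le_norm_cart order_trans unfolding integer_points_def by blast
    then have "vec_nth x \<in> PiE (UNIV :: 'n set) (\<lambda>_. ?F)"
      by auto
    then show "x \<in> vec_lambda ` PiE (UNIV :: 'n set) (\<lambda>_. ?F)"
      using vec_lambda_eta[of x] image_eqI by metis
  qed
  ultimately show ?thesis
    by (rule finite_subset[rotated])
qed

lemma integer_points_add:
  "x \<in> integer_points \<Longrightarrow> y \<in> integer_points \<Longrightarrow> x + y \<in> integer_points"
  by (simp add: integer_points_def)

lemma origin_symmetric_uminus: "origin_symmetric K \<Longrightarrow> x \<in> K \<Longrightarrow> - x \<in> K"
  unfolding origin_symmetric_def by blast

lemma convex_add_mem_double: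
  assumes "convex K" "x \<in> K" "y \<in> K"
  shows "x + y \<in> (*\<^sub>R) 2 ` K"
proof
  show "x + y = 2 *\<^sub>R ((1/2) *\<^sub>R x + (1/2) *\<^sub>R y)"
    by (simp add: scaleR_add_right)
  show "(1/2) *\<^sub>R x + (1/2) *\<^sub>R y \<in> K"
    using assms by (intro convexD) auto
qed

text \<open>With \<open>x = 2u\<close> and \<open>y = 2v\<close>, the point is the midpoint of
  \<open>u\<close> and \<open>-v\<close>, both in \<open>K\<close> by symmetry.\<close>

lemma double_diff_quarter:
  assumes "convex K" "origin_symmetric K" "x \<in> (*\<^sub>R) 2 ` K" "y \<in> (*\<^sub>R) 2 ` K"
  shows "(1/4) *\<^sub>R (x - y) \<in> K"
proof -
  obtain u v where uv: "u \<in> K" "v \<in> K" "x = 2 *\<^sub>R u" "y = 2 *\<^sub>R v"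
    using assms(3,4) by blast
  then have "(1/2) *\<^sub>R u + (1/2) *\<^sub>R (- v) \<in> K"
    using assms(1,2) by (intro convexD origin_symmetric_uminus) auto
  then show ?thesis
    using uv by (simp add: scaleR_diff_right)
qed

lemma zero_mem_symmetric_convex:
  assumes "convex K" "origin_symmetric K" "K \<noteq> {}"
  shows "0 \<in> K"
proof -
  obtain x where "x \<in> K"
    using assms(3) by blast
  then show ?thesis
    using double_diff_quarter[OF assms(1,2), of "2 *\<^sub>R x" "2 *\<^sub>R x"] by simp
qed

text \<open>One coordinate of the congruence argument; on integral reals the floor is only a
  conversion to \<open>int\<close>, where \<open>mod\<close> is available.\<close>

lemma floor_mod_eq_imp_Ints:
  fixes a b :: real
  assumes "a \<in> \<int>" "b \<in> \<int>" "\<lfloor>a\<rfloor> mod 4 = \<lfloor>b\<rfloor> mod 4"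
  shows "(a - b) / 4 \<in> \<int>"
proof -
  obtain i j where ij: "a = of_int i" "b = of_int j"
    using assms(1,2) by (auto elim!: Ints_cases)
  then have "4 dvd i - j"
    using assms(3) by (simp add: mod_eq_dvd_iff)
  then obtain k where "i - j = 4 * k" by blast
  then have "a - b = 4 * of_int k"
    using ij by (metis of_int_diff of_int_mult of_int_numeral)
  then show ?thesis by simp
qed

lemma lattice_count_double_less:
  fixes K :: "(real ^ 'n) set"
  assumes "convex K" "bounded K" "origin_symmetric K" "lattice_count K > 1"
  shows "lattice_count ((*\<^sub>R) 2 ` K) < 4 ^ CARD('n) * lattice_count K"
proof -
  let ?Z = "integer_points :: (real ^ 'n) set"
  let ?D = "(*\<^sub>R) 2 ` K \<inter> ?Z"
  let ?C = "PiE (UNIV :: 'n set) (\<lambda>_. {0..<4::int})"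
  \<comment> \<open>\<open>r x\<close> is the residue vector of \<open>x\<close> modulo 4, and the
    sets \<open>cls c\<close> partition the integer points of \<open>2K\<close>.\<close>
  define r where "r = (\<lambda>x::real ^ 'n. \<lambda>i. \<lfloor>x $ i\<rfloor> mod 4)"
  define cls where "cls c = {x \<in> ?D. r x = c}" for c
  have finK: "finite (K \<inter> ?Z)"
    using assms(2) by (rule finite_bounded_integer_points)
  have finD: "finite ?D"
    using assms(2) by (intro finite_bounded_integer_points bounded_scaling)
  have finC: "finite ?C"
    by (intro finite_PiE) auto
  have quarter: "(1/4) *\<^sub>R (x - y) \<in> K \<inter> ?Z" if "x \<in> cls c" "y \<in> cls c" for x y c
  proof -
    have "r x = r y" "x \<in> ?Z" "y \<in> ?Z"
      using that unfolding cls_def by auto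
    then have "(1/4) *\<^sub>R (x - y) \<in> ?Z"
      unfolding r_def integer_points_def
      using floor_mod_eq_imp_Ints by (auto simp: fun_eq_iff)
    moreover have "(1/4) *\<^sub>R (x - y) \<in> K"
      using that assms(1,3) unfolding cls_def by (intro double_diff_quarter) auto
    ultimately show ?thesis by blast
  qed
  have le: "card (cls c) \<le> lattice_count K" for c
  proof (cases "cls c = {}")
    case False
    then obtain y where y: "y \<in> cls c" by blast
    have "inj_on (\<lambda>x. (1/4::real) *\<^sub>R (x - y)) (cls c)"
      by (auto intro: inj_onI)
    moreover have "(\<lambda>x. (1/4::real) *\<^sub>R (x - y)) ` cls c \<subseteq> K \<inter> ?Z"
      using quarter y by blast
    ultimately show ?thesis
      unfolding lattice_count_def using finK by (rule card_inj_on_le)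
  qed simp
  \<comment> \<open>Taking 0 as base point, \<open>x \<mapsto> x/4\<close> sends the zero class into
    \<open>K/2\<close>. It remains to find an integer point of \<open>K\<close> outside
    \<open>K/2\<close>; one of maximal norm will do.\<close>
  have less: "card (cls (\<lambda>_. 0)) < lattice_count K"
  proof -
    have ne: "K \<inter> ?Z \<noteq> {}"
      using assms(4) unfolding lattice_count_def by auto
    then have K0: "0 \<in> K"
      using assms(1,3) zero_mem_symmetric_convex by blast
    then have zero: "0 \<in> cls (\<lambda>_. 0)"
      unfolding cls_def r_def integer_points_def by force
    have "Max (norm ` (K \<inter> ?Z)) \<in> norm ` (K \<inter> ?Z)"
      using finK ne by (intro Max_in) auto
    then obtain w where "w \<in> K \<inter> ?Z" "norm w = Max (norm ` (K \<inter> ?Z))"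
      by force
    then have w: "w \<in> K \<inter> ?Z" "\<And>v. v \<in> K \<inter> ?Z \<Longrightarrow> norm v \<le> norm w"
      using finK by auto
    have "w \<noteq> 0"
    proof
      assume "w = 0"
      then have "K \<inter> ?Z \<subseteq> {0}"
        using w(2) by auto
      then have "card (K \<inter> ?Z) \<le> card {0 :: real ^ 'n}"
        by (intro card_mono) auto
      then show False
        using assms(4) unfolding lattice_count_def by simp
    qed
    \<comment> \<open>Otherwise \<open>2w\<close> would be an integer point of \<open>K\<close>
      longer than \<open>w\<close>.\<close>
    have "2 *\<^sub>R w \<notin> K"
    proof
      assume "2 *\<^sub>R w \<in> K"
      moreover have "2 *\<^sub>R w \<in> ?Z"
        using w(1) integer_points_add[of w w] by (simp add: scaleR_2)
      ultimately show False
        using w(2)[of "2 *\<^sub>R w"] \<open>w \<noteq> 0\<close> by auto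
    qed
    have "w \<notin> (\<lambda>x. (1/4::real) *\<^sub>R x) ` cls (\<lambda>_. 0)"
    proof
      assume "w \<in> (\<lambda>x. (1/4::real) *\<^sub>R x) ` cls (\<lambda>_. 0)"
      then obtain u where "u \<in> K" "w = (1/4) *\<^sub>R (2 *\<^sub>R u)"
        unfolding cls_def by blast
      then show False
        using \<open>2 *\<^sub>R w \<notin> K\<close> by simp
    qed
    then have "(\<lambda>x. (1/4::real) *\<^sub>R x) ` cls (\<lambda>_. 0) \<subset> K \<inter> ?Z"
      using quarter[OF _ zero] w(1) by auto
    then have "card ((\<lambda>x. (1/4::real) *\<^sub>R x) ` cls (\<lambda>_. 0)) < lattice_count K"
      unfolding lattice_count_def using finK by (rule psubset_card_mono[rotated])
    moreover have "card ((\<lambda>x. (1/4::real) *\<^sub>R x) ` cls (\<lambda>_. 0)) = card (cls (\<lambda>_. 0))"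
      by (intro card_image inj_onI) auto
    ultimately show ?thesis by simp
  qed
  have "r ` ?D \<subseteq> ?C"
    unfolding r_def by auto
  then have "lattice_count ((*\<^sub>R) 2 ` K) = (\<Sum>c\<in>?C. card (cls c))"
    using sum.group[OF finD finC, of r "\<lambda>_. 1::nat"]
    unfolding lattice_count_def cls_def by simp
  also have "\<dots> < (\<Sum>c\<in>?C. lattice_count K)"
    using finC le less by (intro sum_strict_mono_ex1 ballI bexI[of _ "\<lambda>_. 0"]) auto
  also have "\<dots> = 4 ^ CARD('n) * lattice_count K"
    by (simp add: card_PiE)
  finally show ?thesis .
qed

lemma prod_lattice_count_sections_le:
  fixes K :: "(real ^ 'n) set"
  assumes "convex K" "bounded K"
  shows "(\<Prod>i\<in>UNIV. lattice_count (K \<inter> coord_hyperplane i))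
    \<le> lattice_count ((*\<^sub>R) 2 ` K) ^ (CARD('n) - 1)"
proof -
  let ?n = "CARD('n)"
  let ?A = "\<lambda>i::'n. K \<inter> coord_hyperplane i \<inter> integer_points"
  let ?D = "(*\<^sub>R) 2 ` K \<inter> integer_points"
  let ?I = "{..<?n - 1}"
  \<comment> \<open>The index type carries no order, so an enumeration gives meaning to
    "consecutive".\<close>
  obtain h :: "nat \<Rightarrow> 'n" where h: "bij_betw h {0..<?n} UNIV"
    using ex_bij_betw_nat_finite[of "UNIV :: 'n set"] by auto
  define f where "f a = (\<lambda>k\<in>?I. a (h k) + a (h (Suc k)))" for a :: "'n \<Rightarrow> real ^ 'n"
  have finD: "finite ?D"
    using assms(2) by (intro finite_bounded_integer_points bounded_scaling)
  have "inj_on f (PiE UNIV ?A)"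
  proof (rule inj_onI)
    fix a b assume a: "a \<in> PiE UNIV ?A" and b: "b \<in> PiE UNIV ?A" and eq: "f a = f b"
    define d where "d k = a (h k) - b (h k)" for k
    have "a i $ i = 0" "b i $ i = 0" for i
      using PiE_mem[OF a, of i] PiE_mem[OF b, of i] unfolding coord_hyperplane_def by auto
    then have d_zero: "d k $ h k = 0" for k
      by (simp add: d_def)
    have d_Suc: "d (Suc k) = - d k" if "k < ?n - 1" for k
      using fun_cong[OF eq, of k] that unfolding f_def d_def by (simp add: algebra_simps)
    \<comment> \<open>Absolute values hide the alternating sign of \<open>d k\<close>.\<close>
    have d_abs: "k < ?n \<Longrightarrow> \<bar>d k $ j\<bar> = \<bar>d 0 $ j\<bar>" for k j
      by (induction k) (simp_all add: d_Suc)
    have surj: "\<exists>k<?n. h k = i" for i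
      using h unfolding bij_betw_def by (metis UNIV_I atLeastLessThan_iff imageE)
    \<comment> \<open>Choose \<open>k\<close> with \<open>h k = j\<close>: the coordinate
      \<open>j\<close> of \<open>d k\<close> vanishes, hence so does that of
      \<open>d 0\<close>.\<close>
    have "d 0 $ j = 0" for j
      using surj[of j] d_abs d_zero by (metis abs_eq_0)
    then have "d k = 0" if "k < ?n" for k
      using d_abs[OF that] by (simp add: vec_eq_iff)
    then have "a i = b i" for i
      using surj[of i] unfolding d_def by (metis eq_iff_diff_eq_0)
    then show "a = b" by blast
  qed
  moreover have "f ` PiE UNIV ?A \<subseteq> PiE ?I (\<lambda>_. ?D)"
  proof
    fix g assume "g \<in> f ` PiE UNIV ?A"
    then obtain a where a: "a \<in> PiE UNIV ?A" and g: "g = f a" by blast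
    have "a i + a j \<in> ?D" for i j
      using PiE_mem[OF a, of i] PiE_mem[OF a, of j] convex_add_mem_double[OF assms(1)]
        integer_points_add by blast
    then show "g \<in> PiE ?I (\<lambda>_. ?D)"
      unfolding g f_def by auto
  qed
  moreover have "finite (PiE ?I (\<lambda>_. ?D))"
    using finD by (intro finite_PiE) auto
  ultimately have "card (PiE UNIV ?A) \<le> card (PiE ?I (\<lambda>_. ?D))"
    by (rule card_inj_on_le)
  then show ?thesis
    by (simp add: card_PiE lattice_count_def)
qed

theorem theorem1p1:
  fixes K :: "(real ^ 'n) set"
  assumes "CARD('n) \<ge> 2"
    and "convex_body K"
    and "origin_symmetric K"
    and "K \<noteq> {}"
  shows "real (lattice_count K) powr ((real CARD('n) - 1) / real CARD('n))
    > 1 / 4 ^ (CARD('n) - 1) *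
      (\<Prod>i\<in>UNIV. real (lattice_count (K \<inter> coord_hyperplane i))) powr (1 / real CARD('n))"
proof -
  let ?n = "CARD('n)"
  let ?N = "lattice_count K"
  let ?P = "\<Prod>i\<in>UNIV. lattice_count (K \<inter> coord_hyperplane i)"
  have K: "convex K" "bounded K"
    using assms(2) by (auto simp: convex_body_def compact_imp_bounded)
  have fin: "finite (K \<inter> integer_points)"
    using K(2) by (rule finite_bounded_integer_points)
  \<comment> \<open>The origin makes the count positive, as needed below to turn natural powers into
    \<open>powr\<close>.\<close>
  have "0 \<in> K \<inter> integer_points"
    using zero_mem_symmetric_convex[OF K(1) assms(3,4)] by (simp add: integer_points_def)
  then have N: "?N \<ge> 1"
    unfolding lattice_count_def using fin by (metis One_nat_def Suc_leI card_gt_0_iff empty_iff)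
  \<comment> \<open>This is the claim raised to the power \<open>n\<close> and cleared of
    denominators, an inequality between natural numbers.\<close>
  have main: "?P < (4 ^ ?n * ?N) ^ (?n - 1)"
  \<comment> \<open>If 0 is the only integer point of \<open>K\<close>, the zero class gives no
    strictness; but then every section has at most one point, and the right side exceeds 1 as
    \<open>n \<ge> 2\<close>.\<close>
  proof (cases "?N = 1")
    case True
    have "lattice_count (K \<inter> coord_hyperplane i) \<le> 1" for i
      unfolding True[symmetric] unfolding lattice_count_def using fin by (intro card_mono) auto
    then have "?P \<le> 1"
      by (intro prod_le_1) auto
    also have "1 < (4 ^ ?n * ?N) ^ (?n - 1)"
      using True assms(1) one_less_power[of "4::nat" ?n] by (intro one_less_power) auto
    finally show ?thesis .
  next
    case False
    then have "lattice_count ((*\<^sub>R) 2 ` K) < 4 ^ ?n * ?N"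
      using N K assms(3) by (intro lattice_count_double_less) auto
    then have "lattice_count ((*\<^sub>R) 2 ` K) ^ (?n - 1) < (4 ^ ?n * ?N) ^ (?n - 1)"
      using assms(1) by (intro power_strict_mono) auto
    then show ?thesis
      using prod_lattice_count_sections_le[OF K] by linarith
  qed
  \<comment> \<open>Taking \<open>n\<close>-th roots preserves strictness.\<close>
  have "real ?P powr (1 / ?n) < real ((4 ^ ?n * ?N) ^ (?n - 1)) powr (1 / ?n)"
    using main by (intro powr_less_mono2) (simp_all only: of_nat_less_iff of_nat_0_le_iff, simp)
  also have "\<dots> = 4 ^ (?n - 1) * real ?N powr ((real ?n - 1) / ?n)"
  proof -
    have "real ((4 ^ ?n * ?N) ^ (?n - 1)) = (4 ^ (?n - 1)) ^ ?n * real ?N ^ (?n - 1)"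
      by (simp add: power_mult_distrib mult.commute flip: power_mult)
    also have "\<dots> = (4 ^ (?n - 1)) powr ?n * real ?N powr (real ?n - 1)"
      using N assms(1) by (simp flip: powr_realpow)
    finally show ?thesis
      by (simp add: powr_mult powr_powr)
  qed
  finally show ?thesis
    by (simp add: field_simps)
qed

end
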